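(* Consider an instance of edge-weighted online stochastic matching with online vertex types $I$, offline vertices $J$, edges $E\subseteq I\times J$ with nonnegative weights $w_{ij}$, and arrival rates $\lambda_i>0$. Let $(x_{ij})_{(i,j)\in E}$ be any feasible solution of the Jaillet–Lu LP: $$\sum_{j}x_{ij}\le\lambda_i\ (\forall i),\qquad \sum_i x_{ij}\le 1\ (\forall j),\qquad \sum_{i}(2x_{ij}-\lambda_i)^+\le 1-\ln 2\ (\forall j),\qquad x_{ij}\ge 0,$$ (with $x_{ij}=0$ for $(i,j)\notin E$). Then there is an equivalent instance $(I',J',E',w',\lambda')$, obtained from the original one by adding dummy offline vertices and dummy online vertex types (all of whose incident edges have weight $0$) and by splitting online types (each type $i$ is replaced by types $i_1,\dots,i_k$ with the same edge weights to their neighbors and with arrival rates summing to $\lambda_i$, an arriving vertex of type $i$ becoming type $i_u$ with probability $\lambda_{i_u}/\lambda_i$), together with a fractional matching $(x'_{ij})$ on it having the same total weight $\sum w'_{ij}x'_{ij}=\sum w_{ij}x_{ij}$, such that $x'$ satisfies the constraint $\sum_{i\in I'}(2x'_{ij}-\lambda'_i)^+\le 1-\ln 2$ for all $j\in J'$, and moreover $$\sum_{j\in J'}x'_{ij}=\lambda'_i\ \ \forall i\in I',\qquad \sum_{i\in I'}x'_{ij}=1\ \ \forall j\in J',\qquad x'_{ij}\in\{0,\tfrac12\lambda'_i,\lambda'_i\}\ \ \forall (i,j)\in E'.$$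
   Context: Edge-weighted online stochastic matching: a set $I$ of online vertex types, a set $J$ of offline vertices, edges $E$ with nonnegative weights; online vertices arrive with random types (type $i$ at arrival rate $\lambda_i$) and must be immediately and irrevocably matched to an unmatched adjacent offline vertex or discarded; the objective is the expected total weight of matched edges. $(z)^+=\max\{z,0\}$. A dummy vertex/type has all incident edge weights equal to $0$. *)

theory Defs
  imports Complex_Main
begin

text \<open>
  Edge-weighted online stochastic matching.  Only the values of \<open>weight\<close> on \<open>edges\<close> and of
  \<open>rate\<close> on \<open>online\<close> are meaningful.
\<close>

record ('i, 'j) osm_instance =
  online :: "'i set"
  offline :: "'j set"
  edges :: "('i \<times> 'j) set"
  weight :: "'i \<Rightarrow> 'j \<Rightarrow> real"
  rate :: "'i \<Rightarrow> real"

definition valid_instance :: "('i, 'j) osm_instance \<Rightarrow> bool" where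
  "valid_instance G \<longleftrightarrow>
     finite (online G) \<and> finite (offline G) \<and>
     edges G \<subseteq> online G \<times> offline G \<and>
     (\<forall>(i, j)\<in>edges G. 0 \<le> weight G i j) \<and>
     (\<forall>i\<in>online G. 0 < rate G i)"

definition fractional_matching :: "('i, 'j) osm_instance \<Rightarrow> ('i \<Rightarrow> 'j \<Rightarrow> real) \<Rightarrow> bool" where
  "fractional_matching G x \<longleftrightarrow>
     (\<forall>i\<in>online G. \<forall>j\<in>offline G. 0 \<le> x i j) \<and>
     (\<forall>i\<in>online G. \<forall>j\<in>offline G. (i, j) \<notin> edges G \<longrightarrow> x i j = 0) \<and>
     (\<forall>i\<in>online G. (\<Sum>j\<in>offline G. x i j) \<le> rate G i) \<and>
     (\<forall>j\<in>offline G. (\<Sum>i\<in>online G. x i j) \<le> 1)"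

definition jaillet_lu_constraint :: "('i, 'j) osm_instance \<Rightarrow> ('i \<Rightarrow> 'j \<Rightarrow> real) \<Rightarrow> bool" where
  "jaillet_lu_constraint G x \<longleftrightarrow>
     (\<forall>j\<in>offline G. (\<Sum>i\<in>online G. max (2 * x i j - rate G i) 0) \<le> 1 - ln 2)"

definition jaillet_lu_feasible :: "('i, 'j) osm_instance \<Rightarrow> ('i \<Rightarrow> 'j \<Rightarrow> real) \<Rightarrow> bool" where
  "jaillet_lu_feasible G x \<longleftrightarrow> fractional_matching G x \<and> jaillet_lu_constraint G x"

definition total_weight :: "('i, 'j) osm_instance \<Rightarrow> ('i \<Rightarrow> 'j \<Rightarrow> real) \<Rightarrow> real" where
  "total_weight G x = (\<Sum>(i, j)\<in>edges G. weight G i j * x i j)"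

definition dummy_online :: "('i, 'j) osm_instance \<Rightarrow> 'i \<Rightarrow> bool" where
  "dummy_online G i \<longleftrightarrow> (\<forall>j. (i, j) \<in> edges G \<longrightarrow> weight G i j = 0)"

definition dummy_offline :: "('i, 'j) osm_instance \<Rightarrow> 'j \<Rightarrow> bool" where
  "dummy_offline G j \<longleftrightarrow> (\<forall>i. (i, j) \<in> edges G \<longrightarrow> weight G i j = 0)"

text \<open>
  \<open>Inl\<close> marks the original vertices and \<open>Inr\<close> the added dummies.  The sum types provide fresh
  names even when the original vertex types are finite.  Edges incident to a dummy are unrestricted
  apart from having weight 0; between original vertices no edge is added or removed.
\<close>

definition dummy_extension ::
  "('i, 'j) osm_instance \<Rightarrow> ('i + nat, 'j + nat) osm_instance \<Rightarrow> bool" where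
  "dummy_extension G H \<longleftrightarrow>
     valid_instance H \<and>
     (\<exists>A B. online H = Inl ` online G \<union> Inr ` A \<and>
            offline H = Inl ` offline G \<union> Inr ` B \<and>
            (\<forall>a\<in>A. dummy_online H (Inr a)) \<and>
            (\<forall>b\<in>B. dummy_offline H (Inr b))) \<and>
     (\<forall>i j. (Inl i, Inl j) \<in> edges H \<longleftrightarrow> (i, j) \<in> edges G) \<and>
     (\<forall>(i, j)\<in>edges G. weight H (Inl i) (Inl j) = weight G i j) \<and>
     (\<forall>i\<in>online G. rate H (Inl i) = rate G i)"

text \<open>
  The pair \<open>(i, u)\<close> is the copy \<open>i\<^sub>u\<close> of the type \<open>i\<close>.  Every type has finitely many copies, by
  validity, and at least one, since its positive rate is the sum of theirs.
\<close>

definition type_splitting ::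
  "('i, 'j) osm_instance \<Rightarrow> ('i \<times> nat, 'j) osm_instance \<Rightarrow> bool" where
  "type_splitting G H \<longleftrightarrow>
     valid_instance H \<and>
     offline H = offline G \<and>
     fst ` online H \<subseteq> online G \<and>
     (\<forall>(i, u)\<in>online H. \<forall>j. ((i, u), j) \<in> edges H \<longleftrightarrow> (i, j) \<in> edges G) \<and>
     (\<forall>((i, u), j)\<in>edges H. weight H (i, u) j = weight G i j) \<and>
     (\<forall>i\<in>online G. (\<Sum>u | (i, u) \<in> online H. rate H (i, u)) = rate G i)"

text \<open>
  An arrival of type \<open>i\<close> is given the type \<open>i\<^sub>u\<close> with probability \<open>rate H (i, u) / rate G i\<close>, so
  \<open>i\<^sub>u\<close> arrives at rate \<open>rate H (i, u)\<close>.  The following shows that this is a probability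
  distribution on the copies of \<open>i\<close>.
\<close>

lemma type_splitting_probabilities:
  assumes "valid_instance G" "type_splitting G H" "i \<in> online G"
  shows "(\<Sum>u | (i, u) \<in> online H. rate H (i, u) / rate G i) = 1"
    and "(i, u) \<in> online H \<Longrightarrow> 0 < rate H (i, u) / rate G i"
proof -
  have pos: "0 < rate G i"
    using assms(1,3) by (auto simp: valid_instance_def)
  show "(\<Sum>u | (i, u) \<in> online H. rate H (i, u) / rate G i) = 1"
    using assms(2,3) pos by (simp add: type_splitting_def flip: sum_divide_distrib)
  show "0 < rate H (i, u) / rate G i" if "(i, u) \<in> online H"
    using that assms(2) pos by (auto simp: type_splitting_def valid_instance_def)
qed

definition equivalent_instance ::
  "('i, 'j) osm_instance \<Rightarrow> (('i + nat) \<times> nat, 'j + nat) osm_instance \<Rightarrow> bool" where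
  "equivalent_instance G H \<longleftrightarrow> (\<exists>D. dummy_extension G D \<and> type_splitting D H)"

end

theory Submission imports Defs begin

text \<open>
  Offline dummies absorb the unused rate of the online types, spread so thinly that it does not
  enter the Jaillet--Lu sums, and one online dummy type of rate at least 2 fills up all offline
  vertices.  It then remains to split a type of rate \<open>l\<close> whose row \<open>x\<close> sums to \<open>l\<close>.  This is done by
  a symmetric nonnegative matrix \<open>S\<close> with row sums \<open>x\<close> and diagonal \<open>max (2 x\<^sub>a - l) 0\<close>: the entry
  \<open>S a b\<close> is the rate of a copy that is matched half to \<open>a\<close> and half to \<open>b\<close>, so that only the
  diagonal contributes to the Jaillet--Lu sums.  If some \<open>x\<^sub>c\<close> is at least \<open>l/2\<close>, everything else is
  paired with \<open>c\<close>.  Otherwise the vertices fall into three groups of mass at most \<open>l/2\<close> each, and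
  the unique zero-diagonal symmetric \<open>3 \<times> 3\<close> matrix with these row sums is distributed
  proportionally within the groups.
\<close>

section \<open>Symmetric matrices with prescribed row sums and least diagonal\<close>

text \<open>If \<open>k\<close>, \<open>m\<close>, \<open>n\<close> are the three groups, the
  equations for the \<open>3 x 3\<close> matrix force its entry at \<open>k\<close>,
  \<open>m\<close> to be \<open>X k + X m - l / 2 = l / 2 - X n\<close>. This is nonnegative exactly
  because the third group has mass at most \<open>l / 2\<close>.\<close>

lemma symmetric_coupling_of_three_groups:
  fixes x :: "'a \<Rightarrow> real" and g :: "'a \<Rightarrow> nat"
  assumes J: "finite J" and nonneg: "\<And>a. a \<in> J \<Longrightarrow> 0 \<le> x a" and total: "sum x J = l"
    and g: "\<And>a. a \<in> J \<Longrightarrow> g a \<in> {0, 1, 2}"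
    and half: "\<And>k. k \<in> {0, 1, 2} \<Longrightarrow> 2 * sum x {a\<in>J. g a = k} \<le> l"
  shows "\<exists>S. (\<forall>a\<in>J. \<forall>b\<in>J. 0 \<le> S a b) \<and> (\<forall>a b. S a b = S b a) \<and>
             (\<forall>a\<in>J. sum (S a) J = x a) \<and> (\<forall>a. S a a = 0)"
proof -
  define X where "X k = sum x {a\<in>J. g a = k}" for k
  \<comment> \<open>The group entry is weighted by the shares \<open>x a / X (g a)\<close> and
    \<open>x b / X (g b)\<close>. For an empty or massless group the quotient is 0 by
    convention.\<close>
  define S where "S a b = (if g a = g b then 0
      else x a * x b / (X (g a) * X (g b)) * (X (g a) + X (g b) - l / 2))" for a b
  have X_nonneg: "0 \<le> X k" for k
    unfolding X_def by (rule sum_nonneg) (auto intro: nonneg)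
  have X_half: "2 * X k \<le> l" if "k \<in> {0, 1, 2}" for k
    using half[OF that] by (simp add: X_def)
  have group: "(\<Sum>k\<in>{0, 1, 2}. sum f {b\<in>J. g b = k}) = sum f J" for f :: "'a \<Rightarrow> real"
    by (intro sum.group J image_subsetI g) simp
  have X_total: "X 0 + X 1 + X 2 = l"
    using group[of x] total by (simp add: X_def)
  have rows: "sum (S a) J = x a" if a: "a \<in> J" for a
  proof (cases "X (g a) = 0")
    case True
    have "x a = 0"
      using True J nonneg a unfolding X_def by (subst (asm) sum_nonneg_eq_0_iff) auto
    then show ?thesis by (auto simp: S_def intro!: sum.neutral)
  next
    case False
    have slice: "sum (S a) {b\<in>J. g b = k}
        = x a / X (g a) * (if k = g a then 0 else X (g a) + X k - l / 2)"
      if k: "k \<in> {0, 1, 2}" for k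
    proof (cases "k = g a")
      case True
      then show ?thesis by (auto simp: S_def intro!: sum.neutral)
    next
      case ne: False
      have "sum (S a) {b\<in>J. g b = k}
          = (\<Sum>b\<in>{b\<in>J. g b = k}. x b * (x a / (X (g a) * X k) * (X (g a) + X k - l / 2)))"
        using ne by (intro sum.cong) (auto simp: S_def)
      also have "\<dots> = X k * (x a / (X (g a) * X k) * (X (g a) + X k - l / 2))"
        unfolding X_def by (rule sum_distrib_right[symmetric])
      also have "\<dots> = x a / X (g a) * (X (g a) + X k - l / 2)"
      proof (cases "X k = 0")
        case True
        \<comment> \<open>A massless group leaves total \<open>l\<close> to two groups of mass at
          most \<open>l / 2\<close>, so both have mass exactly \<open>l / 2\<close> and the factor
          on the right vanishes as well.\<close>
        have "X (g a) = l / 2"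
          using True ne k g[OF a] X_total X_half[of 0] X_half[of 1] X_half[of 2] by auto
        then show ?thesis using True by simp
      qed simp
      finally show ?thesis using ne by simp
    qed
    have "sum (S a) J = (\<Sum>k\<in>{0, 1, 2}. sum (S a) {b\<in>J. g b = k})"
      by (rule group[symmetric])
    also have "\<dots> = (\<Sum>k\<in>{0, 1, 2}. x a / X (g a) * (if k = g a then 0 else X (g a) + X k - l / 2))"
      by (rule sum.cong[OF refl]) (rule slice)
    also have "\<dots> = x a / X (g a) * (\<Sum>k\<in>{0, 1, 2}. if k = g a then 0 else X (g a) + X k - l / 2)"
      by (rule sum_distrib_left[symmetric])
    \<comment> \<open>The two nonzero terms add up to \<open>2 * X (g a)\<close> plus the masses of
      the other two groups minus \<open>l\<close>.\<close>
    also have "(\<Sum>k\<in>{0, 1, 2}. if k = g a then 0 else X (g a) + X k - l / 2) = X (g a)"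
    proof -
      consider "g a = 0" | "g a = 1" | "g a = 2" using g[OF a] by auto
      then show ?thesis using X_total by cases (simp_all add: field_simps)
    qed
    finally show ?thesis using False by simp
  qed
  have "0 \<le> S a b" if a: "a \<in> J" and b: "b \<in> J" for a b
  proof (cases "g a = g b")
    case False
    have "l / 2 \<le> X (g a) + X (g b)"
      using False g[OF a] g[OF b] X_total X_half[of 0] X_half[of 1] X_half[of 2] by auto
    then show ?thesis
      using False X_nonneg nonneg a b by (auto simp: S_def)
  qed (simp add: S_def)
  moreover have "S a b = S b a" for a b
    by (simp add: S_def mult.commute add.commute)
  moreover have "S a a = 0" for a
    by (simp add: S_def)
  ultimately show ?thesis using rows by blast
qed

text \<open>The diagonal is as small as possible: by symmetry, the entries of row \<open>a\<close>
  off the diagonal are bounded by the other row sums, which total \<open>l - x a\<close>.\<close>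

lemma symmetric_coupling_exists:
  fixes x :: "'a \<Rightarrow> real"
  assumes J: "finite J" and nonneg: "\<And>a. a \<in> J \<Longrightarrow> 0 \<le> x a" and total: "sum x J = l"
  shows "\<exists>S. (\<forall>a\<in>J. \<forall>b\<in>J. 0 \<le> S a b) \<and> (\<forall>a b. S a b = S b a) \<and>
             (\<forall>a\<in>J. sum (S a) J = x a) \<and> (\<forall>a\<in>J. S a a = max (2 * x a - l) 0)"
proof (cases "\<exists>c\<in>J. l \<le> 2 * x c")
  case True
  then obtain c where c: "c \<in> J" "l \<le> 2 * x c" by blast
  define S where "S a b = (if a = c then if b = c then 2 * x c - l else x b
      else if b = c then x a else 0)" for a b
  have rest: "sum x (J - {c}) = l - x c"
    using total sum.remove[OF J c(1), of x] by simp
  \<comment> \<open>Since \<open>l - x c\<close> is at most \<open>l / 2\<close>, the required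
    diagonal is 0 everywhere except possibly at \<open>c\<close>.\<close>
  have le: "x a \<le> l - x c" if "a \<in> J" "a \<noteq> c" for a
    using member_le_sum[of a "J - {c}" x] that J nonneg by (simp add: rest)
  have "sum (S a) J = x a" if "a \<in> J" for a
  proof (cases "a = c")
    case True
    have "sum (S a) J = S c c + sum (S c) (J - {c})"
      using True by (simp add: sum.remove[OF J c(1)])
    also have "sum (S c) (J - {c}) = sum x (J - {c})"
      by (rule sum.cong) (auto simp: S_def)
    finally show ?thesis using True by (simp add: S_def rest)
  next
    case False
    then show ?thesis using c J by (simp add: S_def)
  qed
  moreover have "S a a = max (2 * x a - l) 0" if "a \<in> J" for a
    using c le[OF that] by (auto simp: S_def)
  moreover have "S a b = S b a" for a b
    by (simp add: S_def)
  moreover have "0 \<le> S a b" if "a \<in> J" "b \<in> J" for a b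
    using c nonneg that by (auto simp: S_def)
  ultimately show ?thesis by blast
next
  case False
  then have small: "2 * x a < l" if "a \<in> J" for a using that by force
  show ?thesis
  proof (cases "J = {}")
    case True
    then show ?thesis by (intro exI[of _ "\<lambda>_ _. 0"]) simp
  next
    case nonempty: False
    then obtain a where "a \<in> J" by blast
    then have l: "0 < l" using small[of a] nonneg[of a] by simp
    \<comment> \<open>The groups are a maximal set \<open>A\<close> of mass at most
      \<open>l / 2\<close>, one further vertex \<open>c\<close>, and the rest. By maximality
      \<open>insert c A\<close> has mass above \<open>l / 2\<close>, so the rest has less than
      \<open>l / 2\<close>; \<open>c\<close> alone is light by assumption.\<close>
    define F where "F = {A \<in> Pow J. 2 * sum x A \<le> l}"
    have "finite F" "{} \<in> F" using J l by (auto simp: F_def)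
    then obtain A where A: "A \<in> F" and maximal: "\<And>B. B \<in> F \<Longrightarrow> A \<subseteq> B \<Longrightarrow> A = B"
      using finite_has_maximal[of F] by blast
    have "A \<noteq> J" using A l total by (auto simp: F_def)
    then obtain c where c: "c \<in> J" "c \<notin> A" using A by (auto simp: F_def)
    have "insert c A \<notin> F" using maximal[of "insert c A"] c by blast
    then have gt: "l < 2 * sum x (insert c A)" using A c by (auto simp: F_def)
    define g where "g a = (if a \<in> A then 0 else if a = c then 1 else 2 :: nat)" for a
    have g_range: "g a \<in> {0, 1, 2}" for a by (simp add: g_def)
    have groups: "{a\<in>J. g a = 0} = A" "{a\<in>J. g a = 1} = {c}" "{a\<in>J. g a = 2} = J - insert c A"
      using A c by (auto simp: g_def F_def)
    have "sum x J = sum x (J - insert c A) + sum x (insert c A)"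
      by (rule sum.subset_diff) (use A c J in \<open>auto simp: F_def\<close>)
    then have half: "2 * sum x {a\<in>J. g a = k} \<le> l" if "k \<in> {0, 1, 2}" for k
      using that A gt total small[OF c(1)] groups by (auto simp: F_def)
    obtain S where S: "\<forall>a\<in>J. \<forall>b\<in>J. 0 \<le> S a b" "\<forall>a b. S a b = S b a"
        "\<forall>a\<in>J. sum (S a) J = x a" "\<forall>a. S a a = 0"
      using symmetric_coupling_of_three_groups[OF J nonneg total g_range half] by auto
    then show ?thesis
      using small by (intro exI[of _ S]) (force simp: max_def)
  qed
qed

section \<open>Saturating all vertices with dummies\<close>

text \<open>The slack of each row is spread evenly over \<open>m\<close> offline dummies, and a
  single online dummy supplies the remaining deficit of every column. All new entries are at most
  half the rate of their type, so they add nothing to the Jaillet--Lu sums.\<close>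

lemma saturating_dummy_extension:
  fixes G :: "('i, 'j) osm_instance"
  assumes G: "valid_instance G" and x: "jaillet_lu_feasible G x"
  obtains D :: "('i + nat, 'j + nat) osm_instance" and y where "dummy_extension G D" "fractional_matching D y"
    "total_weight D y = total_weight G x" "jaillet_lu_constraint D y"
    "\<forall>i\<in>online D. (\<Sum>j\<in>offline D. y i j) = rate D i"
    "\<forall>j\<in>offline D. (\<Sum>i\<in>online D. y i j) = 1"
proof -
  let ?I = "online G" and ?J = "offline G"
  have fin: "finite ?I" "finite ?J" and E: "edges G \<subseteq> ?I \<times> ?J"
    and w: "\<And>i j. (i, j) \<in> edges G \<Longrightarrow> 0 \<le> weight G i j"
    and rate_pos: "\<And>i. i \<in> ?I \<Longrightarrow> 0 < rate G i"
    using G by (auto simp: valid_instance_def)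
  have x_nonneg: "\<And>i j. i \<in> ?I \<Longrightarrow> j \<in> ?J \<Longrightarrow> 0 \<le> x i j"
    and x_off: "\<And>i j. i \<in> ?I \<Longrightarrow> j \<in> ?J \<Longrightarrow> (i, j) \<notin> edges G \<Longrightarrow> x i j = 0"
    and x_row: "\<And>i. i \<in> ?I \<Longrightarrow> (\<Sum>j\<in>?J. x i j) \<le> rate G i"
    and x_col: "\<And>j. j \<in> ?J \<Longrightarrow> (\<Sum>i\<in>?I. x i j) \<le> 1"
    and x_jl: "\<And>j. j \<in> ?J \<Longrightarrow> (\<Sum>i\<in>?I. max (2 * x i j - rate G i) 0) \<le> 1 - ln 2"
    using x by (auto simp: jaillet_lu_feasible_def fractional_matching_def jaillet_lu_constraint_def)
  \<comment> \<open>The bound \<open>m \<ge> 2\<close> keeps \<open>s i / m\<close> below half the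
    rate. The total rate plus 2 keeps the dummy columns from overflowing and makes their joint
    deficit at least 2, whence \<open>2 \<le> \<rho>\<close>.\<close>
  define m where "m = nat \<lceil>\<Sum>i\<in>?I. rate G i\<rceil> + 2"
  have m: "(\<Sum>i\<in>?I. rate G i) + 2 \<le> real m"
    unfolding m_def by (simp add: of_nat_ceiling)
  have m2: "2 \<le> real m" by (simp add: m_def)
  define s where "s i = rate G i - (\<Sum>j\<in>?J. x i j)" for i
  have s_nonneg: "0 \<le> s i" if "i \<in> ?I" for i using x_row[OF that] by (simp add: s_def)
  have s_le: "s i \<le> rate G i" if "i \<in> ?I" for i
    using sum_nonneg[of ?J "x i"] x_nonneg that by (simp add: s_def)
  define z where "z i j = (case j of Inl j \<Rightarrow> x i j | Inr b \<Rightarrow> s i / real m)"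
    for i and j :: "'j + nat"
  define J' where "J' = Inl ` ?J \<union> Inr ` {..<m}"
  define r where "r j = 1 - (\<Sum>i\<in>?I. z i j)" for j
  \<comment> \<open>The rate of the online dummy is the total deficit, so that its row is
    tight.\<close>
  define \<rho> where "\<rho> = sum r J'"
  define y where "y i j = (case i of Inl i \<Rightarrow> z i j | Inr a \<Rightarrow> r j)" for i :: "'i + nat" and j
  define D where "D = \<lparr> online = Inl ` ?I \<union> Inr ` {0 :: nat}, offline = J',
    edges = {(i, j). i \<in> Inl ` ?I \<union> Inr ` {0} \<and> j \<in> J' \<and>
      (\<forall>i0 j0. i = Inl i0 \<longrightarrow> j = Inl j0 \<longrightarrow> (i0, j0) \<in> edges G)},
    weight = (\<lambda>i j. case i of Inl i \<Rightarrow> (case j of Inl j \<Rightarrow> weight G i j | Inr _ \<Rightarrow> 0) | Inr _ \<Rightarrow> 0),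
    rate = (\<lambda>i. case i of Inl i \<Rightarrow> rate G i | Inr _ \<Rightarrow> \<rho>) \<rparr>"
  have finJ': "finite J'" using fin by (simp add: J'_def)
  have sumJ': "sum f J' = (\<Sum>j\<in>?J. f (Inl j)) + (\<Sum>b<m. f (Inr b))" for f :: "'j + nat \<Rightarrow> real"
    unfolding J'_def using fin by (subst sum.union_disjoint) (auto simp: sum.reindex)
  have sumI': "sum f (Inl ` ?I \<union> Inr ` {0}) = (\<Sum>i\<in>?I. f (Inl i)) + f (Inr 0)"
    for f :: "'i + nat \<Rightarrow> real"
    using fin by (subst sum.union_disjoint) (auto simp: sum.reindex)
  have s_sum: "(\<Sum>i\<in>?I. s i) \<le> (\<Sum>i\<in>?I. rate G i)"
    by (rule sum_mono) (rule s_le)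
  have z_nonneg: "0 \<le> z i j" if "i \<in> ?I" "j \<in> J'" for i j
    using that s_nonneg x_nonneg by (auto simp: z_def J'_def)
  have r_le: "r j \<le> 1" if "j \<in> J'" for j
    using z_nonneg that by (simp add: r_def sum_nonneg)
  have r_Inr: "r (Inr b) = 1 - (\<Sum>i\<in>?I. s i) / m" for b
    by (simp add: r_def z_def sum_divide_distrib)
  have r_nonneg: "0 \<le> r j" if "j \<in> J'" for j
    using that x_col s_sum m m2 by (auto simp: J'_def r_Inr) (auto simp: r_def z_def)
  have "(\<Sum>b<m. r (Inr b)) = m - (\<Sum>i\<in>?I. s i)"
    using m2 by (simp add: r_Inr right_diff_distrib)
  moreover have "0 \<le> (\<Sum>j\<in>?J. r (Inl j))"
    by (rule sum_nonneg) (simp add: r_nonneg J'_def)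
  ultimately have \<rho>: "2 \<le> \<rho>"
    using m s_sum by (simp add: \<rho>_def sumJ')
  have z_row: "sum (z i) J' = rate G i" for i
    using m2 by (simp add: sumJ' z_def) (simp add: s_def)
  have y_col: "(\<Sum>i\<in>online D. y i j) = 1" for j
    unfolding D_def by (simp add: sumI' y_def r_def del: sum.insert image_insert)
  have y_row: "(\<Sum>j\<in>offline D. y i j) = rate D i" if "i \<in> online D" for i
    using that z_row by (auto simp: D_def y_def \<rho>_def)
  have valid: "valid_instance D"
    unfolding valid_instance_def
    using fin finJ' w rate_pos \<rho> by (auto simp: D_def split: sum.splits)
  have "dummy_extension G D"
    unfolding dummy_extension_def
  proof (intro conjI valid)
    show "\<exists>A B. online D = Inl ` ?I \<union> Inr ` A \<and> offline D = Inl ` ?J \<union> Inr ` B \<and>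
        (\<forall>a\<in>A. dummy_online D (Inr a)) \<and> (\<forall>b\<in>B. dummy_offline D (Inr b))"
      by (intro exI[of _ "{0}"] exI[of _ "{..<m}"])
        (auto simp: D_def J'_def dummy_online_def dummy_offline_def split: sum.splits)
    show "\<forall>i j. (Inl i, Inl j) \<in> edges D \<longleftrightarrow> (i, j) \<in> edges G"
      using E by (auto simp: D_def J'_def)
  qed (auto simp: D_def)
  moreover have "fractional_matching D y"
    unfolding fractional_matching_def
  proof (intro conjI)
    show "\<forall>i\<in>online D. \<forall>j\<in>offline D. 0 \<le> y i j"
      using z_nonneg r_nonneg by (auto simp: D_def y_def)
    show "\<forall>i\<in>online D. \<forall>j\<in>offline D. (i, j) \<notin> edges D \<longrightarrow> y i j = 0"
      using x_off by (auto simp: D_def y_def z_def J'_def)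
  qed (simp_all add: y_row y_col)
  moreover have "total_weight D y = total_weight G x"
  proof -
    let ?h = "\<lambda>(i, j). (Inl i :: 'i + nat, Inl j :: 'j + nat)"
    have sub: "?h ` edges G \<subseteq> edges D" using E by (auto simp: D_def J'_def)
    have finE: "finite (edges D)"
      using valid by (auto simp: valid_instance_def intro: finite_subset)
    have "total_weight D y = (\<Sum>(i, j)\<in>?h ` edges G. weight D i j * y i j)"
      unfolding total_weight_def
      by (rule sum.mono_neutral_right[OF finE sub]) (force simp: D_def split: sum.splits)
    also have "\<dots> = total_weight G x"
      unfolding total_weight_def
      by (subst sum.reindex) (auto simp: inj_on_def D_def y_def z_def intro!: sum.cong)
    finally show ?thesis .
  qed
  moreover have "jaillet_lu_constraint D y"
    unfolding jaillet_lu_constraint_def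
  proof
    fix j assume "j \<in> offline D"
    then have j: "j \<in> J'" by (simp add: D_def)
    \<comment> \<open>The online dummy drops out, since
      \<open>2 * r j \<le> 2 \<le> \<rho>\<close>.\<close>
    have "(\<Sum>i\<in>online D. max (2 * y i j - rate D i) 0) = (\<Sum>i\<in>?I. max (2 * z i j - rate G i) 0)"
      using r_le[OF j] \<rho> unfolding D_def
      by (simp add: sumI' y_def del: sum.insert image_insert)
    also have "\<dots> \<le> 1 - ln 2"
    proof (cases j)
      case (Inl j0)
      then show ?thesis using j x_jl[of j0] by (auto simp: z_def J'_def)
    next
      case (Inr b)
      have "max (2 * z i j - rate G i) 0 = 0" if "i \<in> ?I" for i
      proof -
        have "2 * s i \<le> real m * rate G i"
          using s_le[OF that] s_nonneg[OF that] m2 by (intro mult_mono) auto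
        then show ?thesis using m2 by (simp add: Inr z_def field_simps)
      qed
      then have "(\<Sum>i\<in>?I. max (2 * z i j - rate G i) 0) = 0" by simp
      then show ?thesis using ln_le_minus_one[of "2::real"] by simp
    qed
    finally show "(\<Sum>i\<in>online D. max (2 * y i j - rate D i) 0) \<le> 1 - ln 2" .
  qed
  ultimately show thesis using y_row y_col by (intro that[of D y]) simp_all
qed

section \<open>Splitting saturated types into half-integral copies\<close>

text \<open>Each ordered pair \<open>(a, b)\<close> gives a copy of \<open>i\<close> of rate
  \<open>S i a b\<close>, with half of this rate sent to each of \<open>a\<close> and
  \<open>b\<close>. Column \<open>j\<close> then receives the average of row \<open>j\<close> and
  column \<open>j\<close> of \<open>S i\<close>, which is \<open>x i j\<close> by symmetry.\<close>

lemma half_integral_type_splitting: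
  assumes D: "valid_instance D" and x: "fractional_matching D x"
    and rows: "\<And>i. i \<in> online D \<Longrightarrow> (\<Sum>j\<in>offline D. x i j) = rate D i"
  obtains H y where "type_splitting D H" "fractional_matching H y"
    "total_weight H y = total_weight D x"
    "\<forall>i\<in>online H. (\<Sum>j\<in>offline H. y i j) = rate H i"
    "\<forall>j\<in>offline H. (\<Sum>i\<in>online H. y i j) = (\<Sum>i\<in>online D. x i j)"
    "\<forall>j\<in>offline H. (\<Sum>i\<in>online H. max (2 * y i j - rate H i) 0)
        = (\<Sum>i\<in>online D. max (2 * x i j - rate D i) 0)"
    "\<forall>i j. y i j \<in> {0, rate H i / 2, rate H i}"
proof -
  let ?I = "online D" and ?J = "offline D"
  have fin: "finite ?I" "finite ?J" and E: "edges D \<subseteq> ?I \<times> ?J"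
    and w: "\<And>i j. (i, j) \<in> edges D \<Longrightarrow> 0 \<le> weight D i j"
    using D by (auto simp: valid_instance_def)
  have x_nonneg: "\<And>i j. i \<in> ?I \<Longrightarrow> j \<in> ?J \<Longrightarrow> 0 \<le> x i j"
    and x_off: "\<And>i j. i \<in> ?I \<Longrightarrow> j \<in> ?J \<Longrightarrow> (i, j) \<notin> edges D \<Longrightarrow> x i j = 0"
    and x_col: "\<And>j. j \<in> ?J \<Longrightarrow> (\<Sum>i\<in>?I. x i j) \<le> 1"
    using x by (auto simp: fractional_matching_def)
  have "\<forall>i\<in>?I. \<exists>S. (\<forall>a\<in>?J. \<forall>b\<in>?J. 0 \<le> S a b) \<and> (\<forall>a b. S a b = S b a) \<and>
      (\<forall>a\<in>?J. sum (S a) ?J = x i a) \<and> (\<forall>a\<in>?J. S a a = max (2 * x i a - rate D i) 0)"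
    (is "\<forall>i\<in>?I. \<exists>S. ?P i S")
    using symmetric_coupling_exists[OF fin(2)] x_nonneg rows by blast
  from bchoice[OF this] obtain S where S: "\<forall>i\<in>?I. ?P i (S i)" ..
  have S_nonneg: "\<And>i a b. i \<in> ?I \<Longrightarrow> a \<in> ?J \<Longrightarrow> b \<in> ?J \<Longrightarrow> 0 \<le> S i a b"
    and S_sym: "\<And>i a b. i \<in> ?I \<Longrightarrow> S i a b = S i b a"
    and S_row: "\<And>i a. i \<in> ?I \<Longrightarrow> a \<in> ?J \<Longrightarrow> sum (S i a) ?J = x i a"
    and S_diag: "\<And>i a. i \<in> ?I \<Longrightarrow> a \<in> ?J \<Longrightarrow> S i a a = max (2 * x i a - rate D i) 0"
    using S by blast+
  \<comment> \<open>Copies must be indexed by natural numbers, so the ordered pairs are enumerated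
    by \<open>d\<close>.\<close>
  define N where "N = card (?J \<times> ?J)"
  obtain d where "bij_betw d {0..<N} (?J \<times> ?J)"
    unfolding N_def using fin by (metis ex_bij_betw_nat_finite finite_cartesian_product)
  then have d: "bij_betw d {..<N} (?J \<times> ?J)" by (simp add: lessThan_atLeast0)
  have dJ: "fst (d u) \<in> ?J" "snd (d u) \<in> ?J" if "u < N" for u
    using bij_betwE[OF d] that by (auto simp: mem_Times_iff)
  define R where "R i u = S i (fst (d u)) (snd (d u))" for i u
  \<comment> \<open>Pairs of rate 0 are discarded because a valid instance has positive
    rates.\<close>
  define U where "U i = {u. u < N \<and> 0 < R i u}" for i
  \<comment> \<open>The two indicators add up to 0, 1 or 2, which gives the three admissible values;
    the full rate occurs for the pair \<open>(j, j)\<close>.\<close>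
  define y where "y = (\<lambda>(i, u) j. R i u * (of_bool (fst (d u) = j) + of_bool (snd (d u) = j)) / 2)"
  define H where "H = \<lparr> online = Sigma ?I U, offline = ?J,
    edges = {((i, u), j). i \<in> ?I \<and> u \<in> U i \<and> (i, j) \<in> edges D},
    weight = (\<lambda>(i, u). weight D i), rate = (\<lambda>(i, u). R i u) \<rparr>"
  have finU: "finite (U i)" for i by (simp add: U_def)
  have R_zero: "R i u = 0" if "i \<in> ?I" "u < N" "u \<notin> U i" for i u
    using that S_nonneg[OF that(1) dJ[OF that(2)]] by (simp add: U_def R_def)
  have U_sum: "(\<Sum>u\<in>U i. R i u * f (d u)) = (\<Sum>a\<in>?J. \<Sum>b\<in>?J. S i a b * f (a, b))"
    if i: "i \<in> ?I" for i and f :: "_ \<Rightarrow> real"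
  proof -
    have "(\<Sum>u\<in>U i. R i u * f (d u)) = (\<Sum>u<N. R i u * f (d u))"
      by (rule sum.mono_neutral_left) (use i R_zero in \<open>auto simp: U_def\<close>)
    also have "\<dots> = (\<Sum>(a, b)\<in>?J \<times> ?J. S i a b * f (a, b))"
      unfolding sum.reindex_bij_betw[OF d, symmetric]
      by (simp add: R_def case_prod_beta)
    finally show ?thesis by (simp add: sum.cartesian_product)
  qed
  have y_sum: "(\<Sum>u\<in>U i. y (i, u) j) = x i j" if i: "i \<in> ?I" and j: "j \<in> ?J" for i j
  proof -
    have "(\<Sum>u\<in>U i. y (i, u) j)
        = (\<Sum>a\<in>?J. \<Sum>b\<in>?J. S i a b * ((of_bool (a = j) + of_bool (b = j)) / 2))"
      using U_sum[OF i, of "\<lambda>p. (of_bool (fst p = j) + of_bool (snd p = j)) / 2"]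
      by (simp add: y_def)
    also have "\<dots> = ((\<Sum>a\<in>?J. (\<Sum>b\<in>?J. S i a b) * of_bool (a = j))
        + (\<Sum>a\<in>?J. \<Sum>b\<in>?J. S i a b * of_bool (b = j))) / 2"
      by (simp add: sum.distrib sum_divide_distrib sum_distrib_right distrib_left add_divide_distrib)
    also have "\<dots> = (sum (S i j) ?J + (\<Sum>a\<in>?J. S i a j)) / 2"
      using fin j by (simp add: of_bool_def if_distrib cong: if_cong)
    also have "(\<Sum>a\<in>?J. S i a j) = sum (S i j) ?J"
      using S_sym[OF i] by (intro sum.cong) auto
    finally show ?thesis using S_row[OF i j] by simp
  qed
  have rate_sum: "(\<Sum>u\<in>U i. R i u) = rate D i" if "i \<in> ?I" for i
    using U_sum[OF that, of "\<lambda>_. 1"] S_row[OF that] rows[OF that] by simp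
  \<comment> \<open>A copy contributes its whole rate if its pair is \<open>(j, j)\<close> and
    nothing otherwise, so the sum is the diagonal entry \<open>S i j j\<close>.\<close>
  have diag_sum: "(\<Sum>u\<in>U i. max (2 * y (i, u) j - R i u) 0) = max (2 * x i j - rate D i) 0"
    if i: "i \<in> ?I" and j: "j \<in> ?J" for i j
  proof -
    have "(\<Sum>u\<in>U i. max (2 * y (i, u) j - R i u) 0) = (\<Sum>u\<in>U i. R i u * of_bool (d u = (j, j)))"
      by (rule sum.cong) (auto simp: y_def U_def prod_eq_iff)
    also have "\<dots> = (\<Sum>a\<in>?J. \<Sum>b\<in>?J. S i a b * of_bool ((a, b) = (j, j)))"
      by (rule U_sum[OF i])
    also have "\<dots> = (\<Sum>a\<in>?J. if a = j then S i a j else 0)"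
      using fin j by (intro sum.cong) (auto simp: of_bool_def if_distrib cong: if_cong)
    finally show ?thesis using fin j S_diag[OF i j] by simp
  qed
  have sumH: "sum f (online H) = (\<Sum>i\<in>?I. \<Sum>u\<in>U i. f (i, u))" for f :: "_ \<Rightarrow> real"
    using fin finU by (simp add: H_def sum.Sigma)
  have y_nonneg: "0 \<le> y (i, u) j" if "u \<in> U i" for i u j
    using that by (simp add: y_def U_def)
  have y_row: "(\<Sum>j\<in>offline H. y p j) = rate H p" if "p \<in> online H" for p
    using that dJ fin
    by (auto simp: H_def U_def y_def sum.distrib simp flip: sum_divide_distrib sum_distrib_left)
  have y_col: "(\<Sum>p\<in>online H. y p j) = (\<Sum>i\<in>?I. x i j)" if "j \<in> ?J" for j
    using that by (simp add: sumH y_sum)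
  have valid: "valid_instance H"
    unfolding valid_instance_def using fin finU E w by (auto simp: H_def U_def)
  have "type_splitting D H"
    unfolding type_splitting_def
  proof (intro conjI valid ballI)
    fix i assume i: "i \<in> ?I"
    then have "{u. (i, u) \<in> online H} = U i" by (simp add: H_def)
    then show "(\<Sum>u | (i, u) \<in> online H. rate H (i, u)) = rate D i"
      using rate_sum[OF i] by (simp add: H_def)
  qed (auto simp: H_def)
  moreover have "fractional_matching H y"
    unfolding fractional_matching_def
  proof (intro conjI ballI impI)
    fix p j assume p: "p \<in> online H" and j: "j \<in> offline H"
    show "0 \<le> y p j" using p y_nonneg by (auto simp: H_def)
    assume "(p, j) \<notin> edges H"
    then have i: "fst p \<in> ?I" and u: "snd p \<in> U (fst p)" and "(fst p, j) \<notin> edges D"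
      using p by (auto simp: H_def)
    then have x0: "x (fst p) j = 0" using x_off j by (simp add: H_def)
    \<comment> \<open>The copies share out \<open>x (fst p) j\<close>, which is 0 off the edges;
      being nonnegative, every share vanishes.\<close>
    have "(\<Sum>u\<in>U (fst p). y (fst p, u) j) = 0"
      using y_sum[OF i, of j] j x0 by (simp add: H_def)
    then have "y (fst p, snd p) j = 0"
      using u finU y_nonneg by (subst (asm) sum_nonneg_eq_0_iff) (auto simp only:)
    then show "y p j = 0" by simp
  next
    fix j assume "j \<in> offline H"
    then show "(\<Sum>p\<in>online H. y p j) \<le> 1" using y_col x_col by (simp add: H_def)
  qed (simp add: y_row)
  moreover have "total_weight H y = total_weight D x"
  proof -
    have finE: "finite (edges D)" using E fin by (meson finite_SigmaI finite_subset)
    have "total_weight H y = (\<Sum>((i, j), u)\<in>Sigma (edges D) (\<lambda>(i, j). U i). weight D i j * y (i, u) j)"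
      unfolding total_weight_def
      by (rule sum.reindex_bij_witness[of _ "\<lambda>((i, j), u). ((i, u), j)" "\<lambda>((i, u), j). ((i, j), u)"])
        (use E in \<open>auto simp: H_def\<close>)
    also have "\<dots> = (\<Sum>(i, j)\<in>edges D. \<Sum>u\<in>U i. weight D i j * y (i, u) j)"
      using finE finU by (subst sum.Sigma[symmetric]) (auto simp: case_prod_beta)
    also have "\<dots> = total_weight D x"
      unfolding total_weight_def
      by (rule sum.cong) (use E y_sum in \<open>auto simp flip: sum_distrib_left\<close>)
    finally show ?thesis .
  qed
  moreover have "(\<Sum>p\<in>online H. max (2 * y p j - rate H p) 0) = (\<Sum>i\<in>?I. max (2 * x i j - rate D i) 0)"
    if "j \<in> offline H" for j
    using that diag_sum[of _ j] by (simp add: sumH) (simp add: H_def)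
  moreover have "y p j \<in> {0, rate H p / 2, rate H p}" for p j
    by (cases p) (auto simp: y_def H_def)
  moreover have "offline H = ?J" by (simp add: H_def)
  ultimately show thesis using y_row y_col by (intro that[of H y]) simp_all
qed

text \<open>Saturation comes first because the coupling needs each row to sum to the rate of its
  type. The splitting then preserves the column sums and the Jaillet--Lu sums exactly.\<close>

theorem theorem1:
  fixes G :: "('i, 'j) osm_instance" and x :: "'i \<Rightarrow> 'j \<Rightarrow> real"
  assumes "valid_instance G"
    and "jaillet_lu_feasible G x"
  shows "\<exists>(G' :: (('i + nat) \<times> nat, 'j + nat) osm_instance) x'.
           equivalent_instance G G' \<and>
           fractional_matching G' x' \<and>
           total_weight G' x' = total_weight G x \<and>
           jaillet_lu_constraint G' x' \<and>
           (\<forall>i\<in>online G'. (\<Sum>j\<in>offline G'. x' i j) = rate G' i) \<and>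
           (\<forall>j\<in>offline G'. (\<Sum>i\<in>online G'. x' i j) = 1) \<and>
           (\<forall>(i, j)\<in>edges G'. x' i j \<in> {0, rate G' i / 2, rate G' i})"
proof -
  obtain D y where D: "dummy_extension G D" "fractional_matching D y"
      "total_weight D y = total_weight G x" "jaillet_lu_constraint D y"
    and rows: "\<forall>i\<in>online D. (\<Sum>j\<in>offline D. y i j) = rate D i"
    and cols: "\<forall>j\<in>offline D. (\<Sum>i\<in>online D. y i j) = 1"
    by (rule saturating_dummy_extension[OF assms])
  have valid: "valid_instance D" using D(1) by (simp add: dummy_extension_def)
  obtain H z where H: "type_splitting D H" "fractional_matching H z"
      "total_weight H z = total_weight D y"
    and H_rows: "\<forall>i\<in>online H. (\<Sum>j\<in>offline H. z i j) = rate H i"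
    and H_cols: "\<forall>j\<in>offline H. (\<Sum>i\<in>online H. z i j) = (\<Sum>i\<in>online D. y i j)"
    and H_jl: "\<forall>j\<in>offline H. (\<Sum>i\<in>online H. max (2 * z i j - rate H i) 0)
        = (\<Sum>i\<in>online D. max (2 * y i j - rate D i) 0)"
    and H_half: "\<forall>i j. z i j \<in> {0, rate H i / 2, rate H i}"
    by (rule half_integral_type_splitting[OF valid D(2) rows[rule_format]])
  have offline: "offline H = offline D" using H(1) by (simp add: type_splitting_def)
  have "jaillet_lu_constraint H z"
    using D(4) H_jl offline by (simp add: jaillet_lu_constraint_def)
  moreover have "equivalent_instance G H"
    using D(1) H(1) by (auto simp: equivalent_instance_def)
  moreover have "\<forall>j\<in>offline H. (\<Sum>i\<in>online H. z i j) = 1"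
    using H_cols cols offline by simp
  moreover have "\<forall>(i, j)\<in>edges H. z i j \<in> {0, rate H i / 2, rate H i}"
    using H_half by blast
  ultimately show ?thesis
    using H(2,3) D(3) H_rows by (intro exI[of _ H] exI[of _ z]) simp
qed

end
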